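(* Let $T=(X,\hat X,(\phi_\lambda)_{\lambda\in\hat X})$ be an abstract integral transform, let $I=[0,\infty)$ or $I=\mathbb Z_+$, and let $(P_{s,t})_{s\le t\in I}$ be a hemigroup of Markov kernels on $X$ related with $T$. Then an arbitrary stochastic process $(X_t)_{t\in I}$ on $X$ is a Markov process related with the hemigroup $(P_{s,t})_{s\le t\in I}$ if and only if $$\Bigl(\frac{1}{P_{0,t}(e,\cdot)^\wedge(\lambda)}\cdot\phi_\lambda(X_t)\Bigr)_{t\in I}$$ is a martingale for each $\lambda\in\hat X$ with respect to the canonical filtration $(\mathcal F_t)_{t\in I}$ of $(X_t)_{t\in I}$.
   Context: $C_b(X)$, $C_0(X)$ denote the continuous complex-valued functions on a locally compact Hausdorff space $X$ that are bounded, respectively vanish at infinity; $M_b(X)$, $M^1(X)$ denote the regular bounded Borel measures on $X$, respectively the probability measures among them; $M^+(X)$ denotes the positive (Radon) measures. An abstract integral transform is a triple $T=(X,\hat X,(\phi_\lambda)_{\lambda\in\hat X})$ where $X$ is a second countable, locally compact (Hausdorff) space, $\hat X$ is a locally compact space, $\phi_\lambda\in C_b(X)$ with $|\phi_\lambda(x)|\le 1$ for all $x\in X$, $\lambda\in\hat X$, such that: (1) $\lambda\mapsto\phi_\lambda$ is continuous with respect to the compact-uniform topology on $C_b(X)$; (2) there are $e\in X$ with $\phi_\lambda(e)=1$ for all $\lambda\in\hat X$, and $\hat e\in\hat X$ with $\phi_{\hat e}(x)=1$ for all $x\in X$; (3) there is $\pi\in M^+(\hat X)$ such that for all $f\in L^1(\hat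 X,\pi)$ the function $\check f(x):=\int_{\hat X}f(\lambda)\phi_\lambda(x)\,d\pi(\lambda)$ lies in $C_0(X)$, and $\{\check f: f\in L^1(\hat X,\pi)\}$ is $\|\cdot\|_\infty$-dense in $C_0(X)$. For $\mu\in M_b(X)$ put $\hat\mu(\lambda)=\mu^\wedge(\lambda):=\int_X\phi_\lambda\,d\mu$. A Markov kernel $P$ on $X$ is related with $T$ if $P(x,\cdot)^\wedge(\lambda)=P(e,\cdot)^\wedge(\lambda)\cdot\phi_\lambda(x)$ for all $x\in X$, $\lambda\in\hat X$. Composition of kernels: $P\circ Q(x,A)=\int_X Q(z,A)\,P(x,dz)$. A family $(P_{s,t})_{s\le t\in I}$ of Markov kernels related with $T$ is a (continuous) hemigroup if $P_{s,t}\circ P_{t,u}=P_{s,u}$ for all $s\le t\le u$ in $I$, $P_{t,t}$ is the trivial kernel $P_{t,t}(x,\cdot)=\delta_x$ for $t\in I$, and the mapping $(s,t)\mapsto P_{s,t}(e,\cdot)\in M^1(X)$ is weakly continuous on $\{(s,t)\in I^2:s\le t\}$. A process $(X_t)_{t\in I}$ on $X$ with canonical filtration $\mathcal F_t=\sigma(X_s:s\le t)$ is a Markov process related with the hemigroup if $P(X_t\in B\mid\mathcal F_s)=P_{s,t}(X_s,B)$ a.s. for all $s\le t$ in $I$ and all Borel sets $B\subset X$ (the initial distribution is arbitrary).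
   Formalization: For I = Z_+ it is additionally assumed that P_{0,t}(e,·)^(λ) ≠ 0 for all t and λ, since otherwise the quotient 1/P_{0,t}(e,·)^(λ) is undefined; for I = [0,∞) non-vanishing is proved. *)

theory Defs
  imports "HOL-Probability.Probability"
begin

definition C_0 :: "('a::topological_space \<Rightarrow> complex) set" where
  "C_0 = {f. continuous_on UNIV f \<and> (\<forall>\<epsilon>>0. compact {x. norm (f x) \<ge> \<epsilon>})}"

text \<open>Positive Radon measures on a locally compact Hausdorff space, with the regularity
  properties of the Riesz representation theorem; they need not be sigma-finite.\<close>
definition radon_measure :: "'a::t2_space measure \<Rightarrow> bool" where
  "radon_measure \<mu> \<longleftrightarrow>
     sets \<mu> = sets borel \<and>
     (\<forall>K. compact K \<longrightarrow> emeasure \<mu> K < \<infinity>) \<and>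
     (\<forall>A\<in>sets borel. emeasure \<mu> A = (INF U\<in>{U. open U \<and> A \<subseteq> U}. emeasure \<mu> U)) \<and>
     (\<forall>U. open U \<longrightarrow> emeasure \<mu> U = (SUP K\<in>{K. compact K \<and> K \<subseteq> U}. emeasure \<mu> K))"

definition inverse_transform ::
    "'l measure \<Rightarrow> ('l \<Rightarrow> 'x \<Rightarrow> complex) \<Rightarrow> ('l \<Rightarrow> complex) \<Rightarrow> 'x \<Rightarrow> complex" where
  "inverse_transform \<pi> \<phi> f x = (\<integral>l. f l * \<phi> l x \<partial>\<pi>)"

text \<open>The space is the type \<open>'x\<close> and its dual is the type \<open>'l\<close>. The point \<open>e\<close> is a parameter because
  kernels related with the transform refer to it; assumption \<open>inversion\<close> determines it uniquely.
  Continuity for the compact-uniform topology is uniform convergence on compact sets.\<close>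
locale abstract_integral_transform =
  fixes \<phi> :: "'l::t2_space \<Rightarrow> 'x::{second_countable_topology, t2_space} \<Rightarrow> complex"
    and e :: 'x
  assumes locally_compact_space: "locally compact (UNIV :: 'x set)"
    and locally_compact_dual: "locally compact (UNIV :: 'l set)"
    and phi_bcontfun: "\<phi> l \<in> bcontfun"
    and norm_phi_le_1: "norm (\<phi> l x) \<le> 1"
    and phi_continuous: "compact K \<Longrightarrow> uniform_limit K \<phi> (\<phi> l0) (nhds l0)"
    and phi_e: "\<phi> l e = 1"
    and phi_dual_unit: "\<exists>e'. \<forall>x. \<phi> e' x = 1"
    and inversion: "\<exists>\<pi>. radon_measure \<pi> \<and>
          (\<forall>f. integrable \<pi> f \<longrightarrow> inverse_transform \<pi> \<phi> f \<in> C_0) \<and>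
          (\<forall>g\<in>C_0. \<forall>\<epsilon>>0. \<exists>f. integrable \<pi> f \<and>
             (\<forall>x. norm (inverse_transform \<pi> \<phi> f x - g x) \<le> \<epsilon>))"

definition transform :: "('l \<Rightarrow> 'x \<Rightarrow> complex) \<Rightarrow> 'x measure \<Rightarrow> 'l \<Rightarrow> complex" where
  "transform \<phi> \<mu> l = (\<integral>x. \<phi> l x \<partial>\<mu>)"

definition markov_kernel :: "('x::topological_space \<Rightarrow> 'x measure) \<Rightarrow> bool" where
  "markov_kernel P \<longleftrightarrow> P \<in> borel \<rightarrow>\<^sub>M prob_algebra borel"

definition related_kernel ::
    "('l \<Rightarrow> 'x::topological_space \<Rightarrow> complex) \<Rightarrow> 'x \<Rightarrow> ('x \<Rightarrow> 'x measure) \<Rightarrow> bool" where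
  "related_kernel \<phi> e P \<longleftrightarrow> markov_kernel P \<and>
     (\<forall>x l. transform \<phi> (P x) l = transform \<phi> (P e) l * \<phi> l x)"

text \<open>The monadic bind is the composition \<open>A \<mapsto> \<integral> Q(z,A) P(x,dz)\<close>, see \<open>emeasure_bind\<close>.\<close>
definition kernel_comp ::
    "('x \<Rightarrow> 'x measure) \<Rightarrow> ('x \<Rightarrow> 'x measure) \<Rightarrow> 'x \<Rightarrow> 'x measure" where
  "kernel_comp P Q x = P x \<bind> Q"

definition hemigroup ::
    "('l \<Rightarrow> 'x::topological_space \<Rightarrow> complex) \<Rightarrow> 'x \<Rightarrow> real set
       \<Rightarrow> (real \<Rightarrow> real \<Rightarrow> 'x \<Rightarrow> 'x measure) \<Rightarrow> bool" where
  "hemigroup \<phi> e I P \<longleftrightarrow>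
     (\<forall>s\<in>I. \<forall>t\<in>I. s \<le> t \<longrightarrow> related_kernel \<phi> e (P s t)) \<and>
     (\<forall>s\<in>I. \<forall>t\<in>I. \<forall>u\<in>I. s \<le> t \<longrightarrow> t \<le> u \<longrightarrow> kernel_comp (P s t) (P t u) = P s u) \<and>
     (\<forall>t\<in>I. P t t = return borel) \<and>
     (\<forall>f\<in>(bcontfun :: ('x \<Rightarrow> complex) set).
        continuous_on {(s, t). s \<in> I \<and> t \<in> I \<and> s \<le> t} (\<lambda>(s, t). \<integral>x. f x \<partial>P s t e))"

definition canonical_filtration ::
    "'w measure \<Rightarrow> real set \<Rightarrow> (real \<Rightarrow> 'w \<Rightarrow> 'x::topological_space) \<Rightarrow> real \<Rightarrow> 'w measure" where
  "canonical_filtration M I X t =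
     sigma (space M) {X s -` B \<inter> space M | s B. s \<in> I \<and> s \<le> t \<and> B \<in> sets borel}"

definition markov_process_related ::
    "'w measure \<Rightarrow> real set \<Rightarrow> (real \<Rightarrow> real \<Rightarrow> 'x \<Rightarrow> 'x measure)
       \<Rightarrow> (real \<Rightarrow> 'w \<Rightarrow> 'x::topological_space) \<Rightarrow> bool" where
  "markov_process_related M I P X \<longleftrightarrow>
     (\<forall>s\<in>I. \<forall>t\<in>I. s \<le> t \<longrightarrow> (\<forall>B\<in>sets borel.
        AE w in M. real_cond_exp M (canonical_filtration M I X s)
                     (indicator (X t -` B \<inter> space M)) w = measure (P s t (X s w)) B))"

definition complex_cond_exp :: "'w measure \<Rightarrow> 'w measure \<Rightarrow> ('w \<Rightarrow> complex) \<Rightarrow> 'w \<Rightarrow> complex" where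
  "complex_cond_exp M F f w =
     Complex (real_cond_exp M F (\<lambda>w. Re (f w)) w) (real_cond_exp M F (\<lambda>w. Im (f w)) w)"

definition complex_martingale ::
    "'w measure \<Rightarrow> (real \<Rightarrow> 'w measure) \<Rightarrow> real set \<Rightarrow> (real \<Rightarrow> 'w \<Rightarrow> complex) \<Rightarrow> bool" where
  "complex_martingale M F I Y \<longleftrightarrow>
     filtration (space M) F \<and> (\<forall>t\<in>I. subalgebra M (F t)) \<and>
     (\<forall>t\<in>I. Y t \<in> borel_measurable (F t) \<and> integrable M (Y t)) \<and>
     (\<forall>s\<in>I. \<forall>t\<in>I. s \<le> t \<longrightarrow> (AE w in M. complex_cond_exp M (F s) (Y t) w = Y s w))"

end

theory Submission
  imports Defs
begin

text \<open>Both sides are families of integral identities over the events \<open>A\<close> of \<open>F\<^sub>s\<close>. The Markov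
  property says that the finite measures \<open>B \<mapsto> M(A \<inter> {X\<^sub>t \<in> B})\<close> and \<open>B \<mapsto> \<integral>\<^sub>A P\<^sub>s\<^sub>,\<^sub>t(X\<^sub>s, B) dM\<close>
  coincide. Since \<open>P\<^sub>s\<^sub>,\<^sub>t\<close> is related with the transform and the transforms of \<open>P\<^sub>0\<^sub>,\<^sub>t(e, \<cdot>)\<close> are multiplicative
  along the hemigroup, the martingale property says that these two measures have the same transform.
  Hence everything reduces to two facts: the transform is injective on finite measures, because by
  Fubini's theorem it determines the integrals of the inverse transforms, which are dense in \<open>C_0\<close>;
  and the transform of \<open>P\<^sub>0\<^sub>,\<^sub>t(e, \<cdot>)\<close> has no zeros.\<close>

section \<open>Compact neighbourhoods, Urysohn functions and exhaustions in locally compact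
  Hausdorff spaces\<close>

text \<open>Local compactness gives each point of \<open>K\<close> a compact neighbourhood inside
  \<open>U\<close>; finitely many of their open parts cover \<open>K\<close>, and finite unions keep
  all the inclusions.\<close>

lemma compact_neighbourhood:
  fixes K U :: "'x::t2_space set"
  assumes lc: "locally compact (UNIV :: 'x set)" and K: "compact K" and U: "open U" "K \<subseteq> U"
  obtains V L where "open V" "compact L" "K \<subseteq> V" "V \<subseteq> L" "L \<subseteq> U"
proof -
  have "\<exists>V L. open V \<and> compact L \<and> x \<in> V \<and> V \<subseteq> L \<and> L \<subseteq> U" if "x \<in> K" for x
  proof -
    have "openin (top_of_set UNIV) U" "x \<in> U" using U that by auto
    from locallyE[OF lc this] show ?thesis by (metis open_openin subtopology_UNIV)
  qed
  then obtain V L where VL: "\<And>x. x \<in> K \<Longrightarrow> open (V x) \<and> compact (L x) \<and> x \<in> V x \<and> V x \<subseteq> L x \<and> L x \<subseteq> U"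
    by metis
  obtain F where F: "F \<subseteq> K" "finite F" "K \<subseteq> (\<Union>x\<in>F. V x)"
    using compactE_image[OF K, of K V] VL by blast
  show thesis
  proof
    show "open (\<Union>x\<in>F. V x)" using F VL by blast
    show "compact (\<Union>x\<in>F. L x)" using F VL by blast
    show "K \<subseteq> (\<Union>x\<in>F. V x)" by fact
    show "(\<Union>x\<in>F. V x) \<subseteq> (\<Union>x\<in>F. L x)" "(\<Union>x\<in>F. L x) \<subseteq> U" using F VL by blast+
  qed
qed

text \<open>A locally compact Hausdorff space is completely regular, so the compact set
  \<open>K\<close> can be separated from the closed set \<open>- V\<close>, where \<open>V\<close>
  lies in a compact \<open>L\<close> inside \<open>U\<close>. The resulting function vanishes off
  \<open>V\<close>, so its superlevel sets are closed subsets of \<open>L\<close>, hence compact,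
  which puts it in \<open>C_0\<close>.\<close>

lemma Urysohn_C_0:
  fixes K U :: "'x::t2_space set"
  assumes lc: "locally compact (UNIV :: 'x set)" and K: "compact K" and U: "open U" "K \<subseteq> U"
  obtains f :: "'x \<Rightarrow> real" where "continuous_on UNIV f" "(\<lambda>x. complex_of_real (f x)) \<in> C_0"
    "\<And>x. 0 \<le> f x" "\<And>x. f x \<le> 1" "\<And>x. x \<in> K \<Longrightarrow> f x = 1" "\<And>x. x \<notin> U \<Longrightarrow> f x = 0"
proof -
  obtain V L where V: "open V" "compact L" "K \<subseteq> V" "V \<subseteq> L" "L \<subseteq> U"
    using compact_neighbourhood[OF assms] .
  have "locally_compact_space (euclidean :: 'x topology)"
    unfolding locally_compact_space_def
  proof
    fix x :: 'x
    show "\<exists>U K. openin euclidean U \<and> compactin euclidean K \<and> x \<in> U \<and> U \<subseteq> K"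
      by (rule compact_neighbourhood[OF lc, of "{x}" UNIV]) auto
  qed
  moreover have "Hausdorff_space (euclidean :: 'x topology)"
    unfolding Hausdorff_space_def
  proof (intro allI impI)
    fix x y :: 'x assume "x \<in> topspace euclidean \<and> y \<in> topspace euclidean \<and> x \<noteq> y"
    then obtain U V where "open U" "open V" "x \<in> U" "y \<in> V" "U \<inter> V = {}"
      using hausdorff[of x y] by auto
    then show "\<exists>U V. openin euclidean U \<and> openin euclidean V \<and> x \<in> U \<and> y \<in> V \<and> disjnt U V"
      by (auto simp: disjnt_def)
  qed
  ultimately have "completely_regular_space (euclidean :: 'x topology)"
    by (intro locally_compact_regular_imp_completely_regular_space) auto
  moreover have "closedin euclidean (- V)" "compactin euclidean K" "disjnt K (- V)"
    using V K by (auto simp: disjnt_def)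
  ultimately obtain f :: "'x \<Rightarrow> real" where f: "continuous_map euclidean (top_of_set {0..1}) f"
      "f ` (- V) \<subseteq> {0}" "f ` K \<subseteq> {1}"
    by (metis Urysohn_completely_regular_compact_closed zero_le_one)
  from f(1) have c: "continuous_on UNIV f" and r: "\<And>x. 0 \<le> f x \<and> f x \<le> 1"
    by (auto simp: continuous_map_in_subtopology)
  have "compact {x. norm (complex_of_real (f x)) \<ge> \<epsilon>}" if "\<epsilon> > 0" for \<epsilon>
  proof -
    have "closed {x. norm (complex_of_real (f x)) \<ge> \<epsilon>}"
      by (intro closed_Collect_le continuous_intros continuous_on_compose2[OF c]) auto
    moreover have "{x. norm (complex_of_real (f x)) \<ge> \<epsilon>} \<subseteq> L"
    proof
      fix x assume "x \<in> {x. norm (complex_of_real (f x)) \<ge> \<epsilon>}"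
      then have "f x \<noteq> 0" using that by auto
      then show "x \<in> L" using f(2) V(4) by blast
    qed
    ultimately show ?thesis by (metis compact_Int_closed[OF V(2)] inf.absorb2)
  qed
  then have "(\<lambda>x. complex_of_real (f x)) \<in> C_0"
    unfolding C_0_def using continuous_on_of_real[OF c, where 'a=complex] by simp
  moreover have "f x = 1" if "x \<in> K" for x using f(3) that by auto
  moreover have "f x = 0" if "x \<notin> U" for x using f(2) V(4,5) that by blast
  ultimately show thesis using that[of f] c r by blast
qed

text \<open>Every point of \<open>U\<close> has an open neighbourhood contained in a compact subset
  of \<open>U\<close>. By second countability (Lindelof) countably many of these neighbourhoods
  cover \<open>U\<close>; finite unions of their compact hulls give the exhaustion.\<close>

lemma sigma_compact_open:
  fixes U :: "'x::{second_countable_topology, t2_space} set"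
  assumes lc: "locally compact (UNIV :: 'x set)" and U: "open U"
  obtains K :: "nat \<Rightarrow> 'x set" where "\<And>n. compact (K n)" "incseq K" "(\<Union>n. K n) = U"
proof -
  define \<F> where "\<F> = {V. open V \<and> (\<exists>L. compact L \<and> V \<subseteq> L \<and> L \<subseteq> U)}"
  obtain \<F>' where F': "\<F>' \<subseteq> \<F>" "countable \<F>'" "\<Union>\<F>' = \<Union>\<F>"
    using Lindelof[of \<F>] unfolding \<F>_def by auto
  have un: "\<Union>\<F> = U"
  proof
    show "U \<subseteq> \<Union>\<F>"
    proof
      fix x assume "x \<in> U"
      then obtain V L where "open V" "compact L" "{x} \<subseteq> V" "V \<subseteq> L" "L \<subseteq> U"
        using compact_neighbourhood[OF lc _ U, of "{x}"] by auto
      then show "x \<in> \<Union>\<F>"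
        unfolding \<F>_def by blast
    qed
  qed (auto simp: \<F>_def)
  have "\<forall>V\<in>\<F>. \<exists>L. compact L \<and> V \<subseteq> L \<and> L \<subseteq> U"
    by (auto simp: \<F>_def)
  then obtain L where L: "\<And>V. V \<in> \<F> \<Longrightarrow> compact (L V) \<and> V \<subseteq> L V \<and> L V \<subseteq> U"
    by metis
  \<comment> \<open>The empty set is added so that the enumerated family is nonempty, as
    surjectivity of \<open>from_nat_into\<close> requires.\<close>
  define g where "g = from_nat_into (insert {} \<F>')"
  have g: "range g = insert {} \<F>'"
    unfolding g_def using F' by (intro range_from_nat_into) auto
  have e: "{} \<in> \<F>" unfolding \<F>_def by auto
  have gF: "g n \<in> \<F>" for n
    using g F'(1) e rangeI[of g n] by auto
  define K where "K n = (\<Union>i<n. L (g i))" for n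
  show thesis
  proof
    show "compact (K n)" for n
      unfolding K_def using L[OF gF] by (intro compact_UN) auto
    show "incseq K"
      unfolding K_def by (intro incseq_SucI UN_mono) auto
    show "(\<Union>n. K n) = U"
    proof
      show "(\<Union>n. K n) \<subseteq> U" unfolding K_def using L[OF gF] by auto
      show "U \<subseteq> (\<Union>n. K n)"
      proof
        fix x assume "x \<in> U"
        then obtain V where "V \<in> \<F>'" "x \<in> V" using un F'(3) by auto
        then obtain n where "g n = V" using g by (metis insertCI rangeE)
        \<comment> \<open>\<open>K n\<close> collects the indices below \<open>n\<close>, so
          \<open>g n\<close> first contributes to \<open>K (Suc n)\<close>.\<close>
        then have "x \<in> K (Suc n)" using L[OF gF[of n]] \<open>x \<in> V\<close> unfolding K_def by auto
        then show "x \<in> (\<Union>n. K n)" by blast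
      qed
    qed
  qed
qed

section \<open>Finite Borel measures are determined by their integrals over
  \<open>C_0\<close>\<close>

lemma C_0_borel: "f \<in> C_0 \<Longrightarrow> f \<in> borel_measurable borel"
  unfolding C_0_def by (auto intro: borel_measurable_continuous_onI)

text \<open>The indicator of an open set \<open>U\<close> is the pointwise limit of Urysohn
  functions that are 1 on the compact sets exhausting \<open>U\<close> and 0 off \<open>U\<close>.
  Dominated convergence then gives equal values on open sets, which generate the Borel sets.\<close>

lemma finite_measure_eqI_C_0:
  fixes \<mu> \<nu> :: "'x::{second_countable_topology, t2_space} measure"
  assumes lc: "locally compact (UNIV :: 'x set)"
    and \<mu>: "finite_measure \<mu>" "sets \<mu> = sets borel"
    and \<nu>: "finite_measure \<nu>" "sets \<nu> = sets borel"
    and eq: "\<And>f. f \<in> C_0 \<Longrightarrow> (\<integral>x. f x \<partial>\<mu>) = (\<integral>x. f x \<partial>\<nu>)"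
  shows "\<mu> = \<nu>"
proof -
  interpret M: finite_measure \<mu> by fact
  interpret N: finite_measure \<nu> by fact
  have "measure \<mu> U = measure \<nu> U" if U: "open U" for U
  proof -
    obtain K where K: "\<And>n. compact (K n)" "incseq K" "(\<Union>n. K n) = U"
      using sigma_compact_open[OF lc U] by metis
    have "\<exists>f :: 'x \<Rightarrow> real. continuous_on UNIV f \<and> (\<lambda>x. complex_of_real (f x)) \<in> C_0 \<and>
      (\<forall>x. 0 \<le> f x \<and> f x \<le> 1 \<and> (x \<in> K n \<longrightarrow> f x = 1) \<and> (x \<notin> U \<longrightarrow> f x = 0))" for n
    proof -
      have "K n \<subseteq> U" using K(3) by blast
      from Urysohn_C_0[OF lc K(1) U this] show ?thesis by metis
    qed
    then obtain f :: "nat \<Rightarrow> 'x \<Rightarrow> real" where f: "\<And>n. continuous_on UNIV (f n)"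
      "\<And>n. (\<lambda>x. complex_of_real (f n x)) \<in> C_0"
      "\<And>n x. 0 \<le> f n x" "\<And>n x. f n x \<le> 1" "\<And>n x. x \<in> K n \<Longrightarrow> f n x = 1" "\<And>n x. x \<notin> U \<Longrightarrow> f n x = 0"
      by metis
    have lim: "(\<lambda>n. f n x) \<longlonglongrightarrow> indicator U x" for x
    proof (cases "x \<in> U")
      case True
      then obtain m where "x \<in> K m" using K by blast
      then have "\<forall>\<^sub>F n in sequentially. f n x = 1"
        using K(2) f(5) unfolding eventually_sequentially incseq_def by blast
      then show ?thesis using True by (simp add: tendsto_eventually)
    qed (simp add: f)
    have m[measurable]: "f n \<in> borel_measurable borel" for n
      using f(1) by (rule borel_measurable_continuous_onI)
    have L: "(\<lambda>n. \<integral>x. f n x \<partial>\<rho>) \<longlonglongrightarrow> measure \<rho> U"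
      if "finite_measure \<rho>" and s[measurable_cong]: "sets \<rho> = sets borel" for \<rho>
    proof -
      interpret finite_measure \<rho> by fact
      have [measurable]: "U \<in> sets borel" using U by simp
      have "(\<lambda>n. \<integral>x. f n x \<partial>\<rho>) \<longlonglongrightarrow> (\<integral>x. indicator U x \<partial>\<rho>)"
        by (rule integral_dominated_convergence[where w="\<lambda>_. 1"])
          (use lim f in \<open>auto intro!: AE_I2\<close>)
      then show ?thesis using s U by simp
    qed
    \<comment> \<open>The hypothesis speaks of complex functions; equality of the real integrals is
      recovered from injectivity of the embedding of the reals.\<close>
    have "(\<integral>x. f n x \<partial>\<mu>) = (\<integral>x. f n x \<partial>\<nu>)" for n
      using eq[OF f(2)[of n]] by (simp flip: of_real_eq_iff[where 'a=complex] integral_complex_of_real)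
    with L[OF \<mu>] L[OF \<nu>] show ?thesis
      by (simp add: LIMSEQ_unique)
  qed
  then have "emeasure \<mu> U = emeasure \<nu> U" if "open U" for U
    using that by (simp add: M.emeasure_eq_measure N.emeasure_eq_measure)
  \<comment> \<open>Open sets form an intersection-stable generator, and the constant sequence
    \<open>UNIV\<close> serves as exhaustion because the measures are finite.\<close>
  then show ?thesis
    using \<mu> \<nu> by (intro measure_eqI_generator_eq[where E="{U. open U}" and \<Omega>=UNIV and A="\<lambda>_. UNIV"])
      (auto simp: borel_def Int_stable_def M.emeasure_finite)
qed

section \<open>Borel measurability on products with one second countable factor\<close>

text \<open>The first factor will be the dual space, which may fail to be second countable. For each
  basic set \<open>B\<close> of the second factor, \<open>A B\<close> is the largest open set whose
  product with \<open>B\<close> lies in \<open>W\<close>, an arbitrary union of open sets. Only the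
  union over the basis must be countable.\<close>

lemma open_in_sets_pair_borel:
  fixes W :: "('l::topological_space \<times> 'x::second_countable_topology) set"
  assumes "open W"
  shows "W \<in> sets (borel \<Otimes>\<^sub>M borel)"
proof -
  obtain \<B> :: "'x set set" where B: "countable \<B>" "topological_basis \<B>"
    using ex_countable_basis by blast
  define A where "A B = \<Union>{V. open V \<and> V \<times> B \<subseteq> W}" for B
  have "W = (\<Union>B\<in>\<B>. A B \<times> B)"
  proof
    show "W \<subseteq> (\<Union>B\<in>\<B>. A B \<times> B)"
    proof
      fix p assume p: "p \<in> W"
      obtain V S where VS: "open V" "open S" "p \<in> V \<times> S" "V \<times> S \<subseteq> W"
        using open_prod_elim[OF assms p] by blast
      obtain B where "B \<in> \<B>" "snd p \<in> B" "B \<subseteq> S"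
        using topological_basisE[OF B(2) VS(2), of "snd p"] VS(3) by (metis mem_Times_iff)
      moreover from this have "V \<subseteq> A B"
        using VS unfolding A_def by blast
      ultimately show "p \<in> (\<Union>B\<in>\<B>. A B \<times> B)"
        using VS by (auto simp: mem_Times_iff)
    qed
  qed (auto simp: A_def)
  moreover have "(\<Union>B\<in>\<B>. A B \<times> B) \<in> sets (borel \<Otimes>\<^sub>M borel)"
  proof (rule sets.countable_UN''[OF B(1)])
    fix S assume "S \<in> \<B>"
    then have "open S" "open (A S)"
      using B(2) by (auto simp: A_def topological_basis_open)
    then show "A S \<times> S \<in> sets (borel \<Otimes>\<^sub>M borel)" by (intro pair_measureI) auto
  qed
  ultimately show ?thesis by simp
qed

lemma borel_measurable_pair_continuous_onI:
  fixes f :: "'l::topological_space \<times> 'x::second_countable_topology \<Rightarrow> 'b::topological_space"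
  assumes "continuous_on UNIV f"
  shows "f \<in> borel_measurable (borel \<Otimes>\<^sub>M borel)"
  using assms by (intro borel_measurableI)
    (auto simp: space_pair_measure open_vimage intro!: open_in_sets_pair_borel)

section \<open>Integrals over mixtures of measures, conditional expectations and restriction to
  events\<close>

text \<open>Real and imaginary parts are handled by \<open>integral_bind\<close> and reassembled.
  The uniform bound on \<open>f\<close> supplies integrability for the mixture, for each
  \<open>N x\<close> and for the inner integral as a function of \<open>x\<close>.\<close>

lemma complex_integral_bind:
  fixes f :: "'x \<Rightarrow> complex"
  assumes f[measurable]: "f \<in> borel_measurable K"
    and b: "\<And>x. x \<in> space K \<Longrightarrow> norm (f x) \<le> B"
    and N[measurable]: "N \<in> M \<rightarrow>\<^sub>M subprob_algebra K"
    and fin: "finite_measure M"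
  shows "(\<integral>x. f x \<partial>(M \<bind> N)) = (\<integral>x. \<integral>y. f y \<partial>N x \<partial>M)"
proof -
  interpret finite_measure M by fact
  have e: "AE x in M. emeasure (N x) (space (N x)) \<le> ennreal 1"
    using subprob_space.emeasure_space_le_1[OF subprob_space_kernel[OF N]] by (auto intro!: AE_I2)
  have sN: "sets (N x) = sets K" if "x \<in> space M" for x
    using N that by (rule sets_kernel)
  have iN: "integrable (N x) f" if "x \<in> space M" for x
  proof -
    interpret Nx: subprob_space "N x" using N that by (rule subprob_space_kernel)
    show ?thesis
      using b sets_eq_imp_space_eq[OF sN[OF that]] measurable_cong_sets[OF sN[OF that] refl, of borel] f
      by (intro Nx.integrable_const_bound[where B=B]) (auto intro!: AE_I2)
  qed
  have nb: "norm (\<integral>y. f y \<partial>N x) \<le> B" if "x \<in> space M" for x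
  proof -
    interpret Nx: subprob_space "N x" using N that by (rule subprob_space_kernel)
    have "norm (\<integral>y. f y \<partial>N x) \<le> (\<integral>y. norm (f y) \<partial>N x)" by (rule integral_norm_bound)
    also have "\<dots> \<le> (\<integral>y. B \<partial>N x)"
      using b sets_eq_imp_space_eq[OF sN[OF that]] iN[OF that] by (intro integral_mono) auto
    also have "\<dots> \<le> B"
    proof -
      \<comment> \<open>The space of a subprobability measure is nonempty, so \<open>B\<close>
        dominates some norm. Its sign matters since the total mass of \<open>N x\<close> may be less
        than 1.\<close>
      have "0 \<le> B" using b sets_eq_imp_space_eq[OF sN[OF that]] Nx.subprob_not_empty norm_ge_zero
        by (metis all_not_in_conv order_trans)
      then show ?thesis using Nx.subprob_measure_le_1[of "space (N x)"] by (simp add: mult_left_le_one_le)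
    qed
    finally show ?thesis .
  qed
  have meas: "(\<lambda>x. \<integral>y. f y \<partial>N x) \<in> borel_measurable M"
    by (rule measurable_compose[OF N integral_measurable_subprob_algebra[OF f]])
  have iM: "integrable M (\<lambda>x. \<integral>y. f y \<partial>N x)"
    using nb meas by (intro integrable_const_bound[where B=B]) auto
  have bR: "\<bar>Re (f x)\<bar> \<le> B" "\<bar>Im (f x)\<bar> \<le> B" if "x \<in> space K" for x
    using b[OF that] abs_Re_le_cmod[of "f x"] abs_Im_le_cmod[of "f x"] by linarith+
  have R: "integrable (M \<bind> N) (\<lambda>x. Re (f x))" "(\<integral>x. Re (f x) \<partial>(M \<bind> N)) = (\<integral>x. \<integral>y. Re (f y) \<partial>N x \<partial>M)"
    using bR N fin e by (intro integrable_bind[where K=K and B=B and B'=1] integral_bind[where K=K and B=B and B'=1]; auto)+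
  have I: "integrable (M \<bind> N) (\<lambda>x. Im (f x))" "(\<integral>x. Im (f x) \<partial>(M \<bind> N)) = (\<integral>x. \<integral>y. Im (f y) \<partial>N x \<partial>M)"
    using bR N fin e by (intro integrable_bind[where K=K and B=B and B'=1] integral_bind[where K=K and B=B and B'=1]; auto)+
  have i: "integrable (M \<bind> N) f"
  proof -
    have "integrable (M \<bind> N) (\<lambda>x. complex_of_real (Re (f x)) + \<i> * complex_of_real (Im (f x)))"
      using R(1) I(1) by (intro Bochner_Integration.integrable_add integrable_mult_right integrable_of_real)
    then show ?thesis by (simp flip: complex_eq)
  qed
  show ?thesis
  proof (rule complex_eqI)
    have "(\<integral>x. \<integral>y. Re (f y) \<partial>N x \<partial>M) = (\<integral>x. Re (\<integral>y. f y \<partial>N x) \<partial>M)"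
      using iN by (intro Bochner_Integration.integral_cong) auto
    then show "Re (\<integral>x. f x \<partial>(M \<bind> N)) = Re (\<integral>x. \<integral>y. f y \<partial>N x \<partial>M)"
      using i R(2) iM by simp
    have "(\<integral>x. \<integral>y. Im (f y) \<partial>N x \<partial>M) = (\<integral>x. Im (\<integral>y. f y \<partial>N x) \<partial>M)"
      using iN by (intro Bochner_Integration.integral_cong) auto
    then show "Im (\<integral>x. f x \<partial>(M \<bind> N)) = Im (\<integral>x. \<integral>y. f y \<partial>N x \<partial>M)"
      using i I(2) iM by simp
  qed
qed

text \<open>This exchanges the almost everywhere statements for numerical identities over events, so
  that measures can be compared one event at a time.\<close>

lemma (in sigma_finite_subalgebra) real_cond_exp_charact_iff:
  assumes f: "integrable M f" and g: "integrable M g" "g \<in> borel_measurable F"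
  shows "(AE w in M. real_cond_exp M F f w = g w) \<longleftrightarrow>
    (\<forall>A\<in>sets F. (\<integral>w\<in>A. f w \<partial>M) = (\<integral>w\<in>A. g w \<partial>M))"
proof
  assume ae: "AE w in M. real_cond_exp M F f w = g w"
  show "\<forall>A\<in>sets F. (\<integral>w\<in>A. f w \<partial>M) = (\<integral>w\<in>A. g w \<partial>M)"
  proof
    fix A assume A: "A \<in> sets F"
    then have AM: "A \<in> sets M" using subalg by (auto simp: subalgebra_def)
    have "(\<integral>w\<in>A. f w \<partial>M) = (\<integral>w\<in>A. real_cond_exp M F f w \<partial>M)"
      using f A by (rule real_cond_exp_intA)
    also have "\<dots> = (\<integral>w\<in>A. g w \<partial>M)"
      using ae AM g(1) by (intro set_lebesgue_integral_cong_AE) auto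
    finally show "(\<integral>w\<in>A. f w \<partial>M) = (\<integral>w\<in>A. g w \<partial>M)" .
  qed
qed (use assms real_cond_exp_charact in blast)

text \<open>Conditional expectations and set integrals both split into real and imaginary parts, so
  the real characterisation is applied to each.\<close>

lemma (in sigma_finite_subalgebra) complex_cond_exp_charact:
  fixes f g :: "'a \<Rightarrow> complex"
  assumes f: "integrable M f" and g: "integrable M g" "g \<in> borel_measurable F"
  shows "(AE w in M. complex_cond_exp M F f w = g w) \<longleftrightarrow>
    (\<forall>A\<in>sets F. (\<integral>w\<in>A. f w \<partial>M) = (\<integral>w\<in>A. g w \<partial>M))"
proof -
  have sub: "A \<in> sets M" if "A \<in> sets F" for A
    using that subalg by (auto simp: subalgebra_def)
  have RI: "Re (\<integral>w\<in>A. h w \<partial>M) = (\<integral>w\<in>A. Re (h w) \<partial>M)" "Im (\<integral>w\<in>A. h w \<partial>M) = (\<integral>w\<in>A. Im (h w) \<partial>M)"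
    if "integrable M h" "A \<in> sets F" for h :: "'a \<Rightarrow> complex" and A
  proof -
    have "integrable M (\<lambda>w. indicator A w *\<^sub>R h w)"
      using integrable_mult_indicator[OF sub that(1)] that by simp
    then show "Re (\<integral>w\<in>A. h w \<partial>M) = (\<integral>w\<in>A. Re (h w) \<partial>M)" "Im (\<integral>w\<in>A. h w \<partial>M) = (\<integral>w\<in>A. Im (h w) \<partial>M)"
      unfolding set_lebesgue_integral_def
      by (simp_all flip: integral_Re integral_Im)
  qed
  have "(AE w in M. complex_cond_exp M F f w = g w) \<longleftrightarrow>
    (AE w in M. real_cond_exp M F (\<lambda>w. Re (f w)) w = Re (g w)) \<and>
    (AE w in M. real_cond_exp M F (\<lambda>w. Im (f w)) w = Im (g w))"
    by (simp add: complex_cond_exp_def complex_eq_iff)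
  also have "\<dots> \<longleftrightarrow> (\<forall>A\<in>sets F. (\<integral>w\<in>A. Re (f w) \<partial>M) = (\<integral>w\<in>A. Re (g w) \<partial>M)) \<and>
     (\<forall>A\<in>sets F. (\<integral>w\<in>A. Im (f w) \<partial>M) = (\<integral>w\<in>A. Im (g w) \<partial>M))"
    using f g by (intro arg_cong2[where f="(\<and>)"] real_cond_exp_charact_iff) auto
  also have "\<dots> \<longleftrightarrow> (\<forall>A\<in>sets F. (\<integral>w\<in>A. f w \<partial>M) = (\<integral>w\<in>A. g w \<partial>M))"
    using RI[OF f] RI[OF g(1)] by (auto simp: complex_eq_iff)
  finally show ?thesis .
qed

text \<open>This density restricts \<open>M\<close> to the event \<open>A\<close> without changing
  the measurable space, so results on finite measures apply to integrals over events.\<close>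

lemma integral_density_indicator:
  fixes f :: "'a \<Rightarrow> 'b::{banach, second_countable_topology}"
  assumes "A \<in> sets M" "f \<in> borel_measurable M"
  shows "(\<integral>w. f w \<partial>density M (\<lambda>w. ennreal (indicator A w))) = (\<integral>w\<in>A. f w \<partial>M)"
  unfolding set_lebesgue_integral_def using assms by (intro integral_density) auto

section \<open>Joint continuity, Fubini's theorem and injectivity of the transform\<close>

context abstract_integral_transform
begin

text \<open>Near \<open>(l0, x0)\<close> the error splits into
  \<open>dist (\<phi> l x) (\<phi> l0 x)\<close>, small uniformly on a compact neighbourhood of
  \<open>x0\<close>, and \<open>dist (\<phi> l0 x) (\<phi> l0 x0)\<close>, small by continuity of
  \<open>\<phi> l0\<close>.\<close>

lemma phi_jointly_continuous: "continuous_on UNIV (\<lambda>(l, x). \<phi> l x)"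
proof -
  have "((\<lambda>(l, x). \<phi> l x) \<longlongrightarrow> \<phi> l0 x0) (nhds (l0, x0))" for l0 x0
  proof (rule tendstoI)
    fix \<epsilon> :: real assume "\<epsilon> > 0"
    obtain V L where V: "open V" "compact L" "x0 \<in> V" "V \<subseteq> L"
      using compact_neighbourhood[OF locally_compact_space, of "{x0}" UNIV] by auto
    have "\<forall>\<^sub>F l in nhds l0. \<forall>x\<in>L. dist (\<phi> l x) (\<phi> l0 x) < \<epsilon> / 2"
      using phi_continuous[OF V(2)] \<open>\<epsilon> > 0\<close> by (intro uniform_limitD) auto
    moreover have "continuous_on UNIV (\<phi> l0)"
      using phi_bcontfun by (auto simp: bcontfun_def)
    then have "(\<phi> l0 \<longlongrightarrow> \<phi> l0 x0) (nhds x0)"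
      by (simp add: continuous_on_eq_continuous_at continuous_at tendsto_at_iff_tendsto_nhds)
    then have "\<forall>\<^sub>F x in nhds x0. dist (\<phi> l0 x) (\<phi> l0 x0) < \<epsilon> / 2"
      using \<open>\<epsilon> > 0\<close> by (intro tendstoD) auto
    moreover have "\<forall>\<^sub>F x in nhds x0. x \<in> V"
      using V by (intro eventually_nhds_in_open)
    ultimately have "\<forall>\<^sub>F p in nhds l0 \<times>\<^sub>F nhds x0. (\<forall>x\<in>L. dist (\<phi> (fst p) x) (\<phi> l0 x) < \<epsilon> / 2) \<and>
        (dist (\<phi> l0 (snd p)) (\<phi> l0 x0) < \<epsilon> / 2 \<and> snd p \<in> V)"
      by (intro eventually_prodI eventually_conj)
    then show "\<forall>\<^sub>F p in nhds (l0, x0). dist (case p of (l, x) \<Rightarrow> \<phi> l x) (\<phi> l0 x0) < \<epsilon>"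
      unfolding nhds_prod
    proof (rule eventually_mono, clarsimp)
      fix l x assume *: "\<forall>x\<in>L. dist (\<phi> l x) (\<phi> l0 x) * 2 < \<epsilon>" "dist (\<phi> l0 x) (\<phi> l0 x0) * 2 < \<epsilon>" "x \<in> V"
      then have "dist (\<phi> l x) (\<phi> l0 x) * 2 < \<epsilon>" using V by blast
      with * dist_triangle[of "\<phi> l x" "\<phi> l0 x0" "\<phi> l0 x"]
      show "dist (\<phi> l x) (\<phi> l0 x0) < \<epsilon>" by linarith
    qed
  qed
  then show ?thesis
    by (auto simp: continuous_on_eq_continuous_at continuous_at tendsto_at_iff_tendsto_nhds)
qed

lemma phi_measurable_pair: "(\<lambda>(l, x). \<phi> l x) \<in> borel_measurable (borel \<Otimes>\<^sub>M borel)"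
  by (rule borel_measurable_pair_continuous_onI[OF phi_jointly_continuous])

lemma phi_measurable [measurable]: "\<phi> l \<in> borel_measurable borel"
  using phi_bcontfun[of l] by (auto simp: bcontfun_def intro: borel_measurable_continuous_onI)

lemma norm_inverse_transform_le:
  assumes "integrable \<pi> f"
  shows "norm (inverse_transform \<pi> \<phi> f x) \<le> (\<integral>l. norm (f l) \<partial>\<pi>)"
proof -
  have "norm (inverse_transform \<pi> \<phi> f x) \<le> (\<integral>l. norm (f l * \<phi> l x) \<partial>\<pi>)"
    unfolding inverse_transform_def by (rule integral_norm_bound)
  also have "\<dots> \<le> (\<integral>l. norm (f l) \<partial>\<pi>)"
    using assms norm_phi_le_1
    by (intro integral_mono') (auto simp: norm_mult intro!: mult_right_le_one_le)
  finally show ?thesis .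
qed

text \<open>The measure \<open>\<pi>\<close> need not be sigma-finite, so Fubini's theorem is applied to the
  finite measure with density \<open>norm f\<close> instead.\<close>
lemma integral_inverse_transform:
  assumes s\<pi>: "sets \<pi> = sets borel" and f: "integrable \<pi> f"
    and \<mu>: "finite_measure \<mu>" and s\<mu>: "sets \<mu> = sets borel"
  shows "(\<integral>x. inverse_transform \<pi> \<phi> f x \<partial>\<mu>) = (\<integral>l. f l * transform \<phi> \<mu> l \<partial>\<pi>)"
proof -
  note [measurable_cong] = s\<pi> s\<mu>
  have [measurable]: "f \<in> borel_measurable borel"
    using f measurable_cong_sets[OF s\<pi> refl, of borel] by auto
  define \<rho> where "\<rho> = density \<pi> (\<lambda>l. ennreal (norm (f l)))"
  have s\<rho>[measurable_cong]: "sets \<rho> = sets borel" by (simp add: \<rho>_def s\<pi>)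
  interpret \<rho>: finite_measure \<rho>
  proof
    have "emeasure \<rho> (space \<rho>) = (\<integral>\<^sup>+l. ennreal (norm (f l)) \<partial>\<pi>)"
      unfolding \<rho>_def by (subst emeasure_density) (auto intro!: nn_integral_cong)
    then show "emeasure \<rho> (space \<rho>) \<noteq> \<infinity>"
      using f by (simp add: integrable_iff_bounded)
  qed
  interpret \<mu>: finite_measure \<mu> by fact
  interpret P: pair_sigma_finite \<rho> \<mu> ..
  interpret Q: finite_measure "\<rho> \<Otimes>\<^sub>M \<mu>"
    by (rule finite_measure_pair_measure) unfold_locales
  \<comment> \<open>Polar decomposition: the modulus of \<open>f\<close> is absorbed into
    \<open>\<rho>\<close>, which leaves the factor \<open>sgn f\<close> of modulus at most 1. Thus
    the Fubini integrand is bounded on a finite product measure.\<close>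
  have d: "(\<integral>l. g l * f l \<partial>\<pi>) = (\<integral>l. g l * sgn (f l) \<partial>\<rho>)" if [measurable]: "g \<in> borel_measurable borel" for g
  proof -
    have "(\<integral>l. g l * sgn (f l) \<partial>\<rho>) = (\<integral>l. norm (f l) *\<^sub>R (g l * sgn (f l)) \<partial>\<pi>)"
      unfolding \<rho>_def by (intro integral_density) auto
    also have "\<dots> = (\<integral>l. g l * f l \<partial>\<pi>)"
      by (intro Bochner_Integration.integral_cong) (auto simp: sgn_eq scaleR_conv_of_real)
    finally show ?thesis by simp
  qed
  have [measurable]: "(\<lambda>l. \<phi> l x) \<in> borel_measurable borel" for x
    using measurable_compose[OF _ phi_measurable_pair, of "\<lambda>l. (l, x)" borel] by simp
  have m: "(\<lambda>(l, x). \<phi> l x * sgn (f l)) \<in> borel_measurable (borel \<Otimes>\<^sub>M borel)"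
    using phi_measurable_pair by (auto simp: split_beta intro!: borel_measurable_times) measurable
  have i: "integrable (\<rho> \<Otimes>\<^sub>M \<mu>) (\<lambda>(l, x). \<phi> l x * sgn (f l))"
  proof (rule Q.integrable_const_bound[where B=1])
    show "AE p in \<rho> \<Otimes>\<^sub>M \<mu>. norm (case p of (l, x) \<Rightarrow> \<phi> l x * sgn (f l)) \<le> 1"
      using norm_phi_le_1 by (auto simp: norm_mult norm_sgn)
    show "(\<lambda>(l, x). \<phi> l x * sgn (f l)) \<in> borel_measurable (\<rho> \<Otimes>\<^sub>M \<mu>)"
      using m measurable_cong_sets[OF sets_pair_measure_cong[OF s\<rho> s\<mu>] refl, of borel] by auto
  qed
  \<comment> \<open>After the integrals are exchanged, \<open>d\<close> is applied again with this
    function as \<open>g\<close>, so its measurability is needed.\<close>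
  have [measurable]: "(\<lambda>l. transform \<phi> \<mu> l) \<in> borel_measurable borel"
    unfolding transform_def
    using \<mu>.borel_measurable_lebesgue_integral[of "\<phi>" borel] phi_measurable_pair
     measurable_cong_sets[OF sets_pair_measure_cong[OF refl s\<mu>] refl, of "borel :: 'l measure" borel] by auto
  have "(\<integral>x. inverse_transform \<pi> \<phi> f x \<partial>\<mu>) = (\<integral>x. \<integral>l. \<phi> l x * sgn (f l) \<partial>\<rho> \<partial>\<mu>)"
    unfolding inverse_transform_def by (simp add: mult.commute[of "f _"] d)
  also have "\<dots> = (\<integral>l. \<integral>x. \<phi> l x * sgn (f l) \<partial>\<mu> \<partial>\<rho>)"
    by (rule P.Fubini_integral[OF i])
  also have "\<dots> = (\<integral>l. transform \<phi> \<mu> l * sgn (f l) \<partial>\<rho>)"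
    by (simp add: transform_def)
  also have "\<dots> = (\<integral>l. f l * transform \<phi> \<mu> l \<partial>\<pi>)"
    by (simp add: mult.commute[of "f _"] d)
  finally show ?thesis .
qed

text \<open>Equal transforms force equal integrals of all inverse transforms. Uniform approximation
  extends this to \<open>C_0\<close>, because integration against a finite measure is continuous for
  the supremum norm.\<close>

lemma transform_inject:
  assumes \<mu>: "finite_measure \<mu>" "sets \<mu> = sets borel"
    and \<nu>: "finite_measure \<nu>" "sets \<nu> = sets borel"
    and eq: "\<And>l. transform \<phi> \<mu> l = transform \<phi> \<nu> l"
  shows "\<mu> = \<nu>"
proof (rule finite_measure_eqI_C_0[OF locally_compact_space \<mu> \<nu>])
  fix g :: "'x \<Rightarrow> complex" assume g: "g \<in> C_0"
  obtain \<pi> where "radon_measure \<pi>"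
    and C0: "\<And>f. integrable \<pi> f \<Longrightarrow> inverse_transform \<pi> \<phi> f \<in> C_0"
    and dense: "\<And>g \<epsilon>. g \<in> C_0 \<Longrightarrow> \<epsilon> > 0 \<Longrightarrow> \<exists>f. integrable \<pi> f \<and>
             (\<forall>x. norm (inverse_transform \<pi> \<phi> f x - g x) \<le> \<epsilon>)"
    using inversion by metis
  then have s\<pi>: "sets \<pi> = sets borel" by (simp add: radon_measure_def)
  have close: "norm ((\<integral>x. inverse_transform \<pi> \<phi> f x \<partial>\<rho>) - (\<integral>x. g x \<partial>\<rho>)) \<le> \<epsilon> * measure \<rho> (space \<rho>)"
    if \<rho>: "finite_measure \<rho>" and [measurable_cong]: "sets \<rho> = sets borel"
      and f: "integrable \<pi> f" and e: "\<And>x. norm (inverse_transform \<pi> \<phi> f x - g x) \<le> \<epsilon>" for \<rho> f \<epsilon>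
  proof -
    interpret finite_measure \<rho> by fact
    note [measurable] = C_0_borel[OF g] C_0_borel[OF C0[OF f]]
    have i1: "integrable \<rho> (inverse_transform \<pi> \<phi> f)"
      using norm_inverse_transform_le[OF f] by (intro integrable_const_bound) (auto intro!: AE_I2)
    have i2: "integrable \<rho> (\<lambda>x. inverse_transform \<pi> \<phi> f x - g x)"
      using e by (intro integrable_const_bound) (auto intro!: AE_I2)
    \<comment> \<open>This difference simplifies to \<open>g\<close>, which is thereby integrable as
      a function uniformly close to a bounded one.\<close>
    have "integrable \<rho> (\<lambda>x. inverse_transform \<pi> \<phi> f x - (inverse_transform \<pi> \<phi> f x - g x))"
      using i1 i2 by (rule Bochner_Integration.integrable_diff)
    then have "(\<integral>x. inverse_transform \<pi> \<phi> f x \<partial>\<rho>) - (\<integral>x. g x \<partial>\<rho>) = (\<integral>x. inverse_transform \<pi> \<phi> f x - g x \<partial>\<rho>)"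
      using i1 by simp
    also have "norm \<dots> \<le> (\<integral>x. norm (inverse_transform \<pi> \<phi> f x - g x) \<partial>\<rho>)"
      by (rule integral_norm_bound)
    also have "\<dots> \<le> (\<integral>x. \<epsilon> \<partial>\<rho>)"
      using e order_trans[OF norm_ge_zero e] by (intro integral_mono') auto
    finally show ?thesis by (simp add: mult.commute)
  qed
  define c where "c = measure \<mu> (space \<mu>) + measure \<nu> (space \<nu>)"
  have "norm ((\<integral>x. g x \<partial>\<mu>) - (\<integral>x. g x \<partial>\<nu>)) \<le> \<epsilon> * c" if "\<epsilon> > 0" for \<epsilon>
  proof -
    obtain f where f: "integrable \<pi> f" "\<And>x. norm (inverse_transform \<pi> \<phi> f x - g x) \<le> \<epsilon>"
      using dense[OF g \<open>\<epsilon> > 0\<close>] by blast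
    have "(\<integral>x. inverse_transform \<pi> \<phi> f x \<partial>\<mu>) = (\<integral>x. inverse_transform \<pi> \<phi> f x \<partial>\<nu>)"
      using integral_inverse_transform[OF s\<pi> f(1)] \<mu> \<nu> eq by simp
    then show ?thesis
      using norm_triangle_le_diff[OF add_mono[OF close[OF \<nu> f] close[OF \<mu> f]]]
      by (simp add: c_def distrib_left add.commute)
  qed
  note le = this
  have "c \<ge> 0" by (simp add: c_def)
  have "norm ((\<integral>x. g x \<partial>\<mu>) - (\<integral>x. g x \<partial>\<nu>)) \<le> 0"
  proof (rule field_le_epsilon)
    \<comment> \<open>The approximation error is taken as \<open>\<delta> / (c + 1)\<close>; the
      denominator stays positive even when both measures vanish.\<close>
    fix \<delta> :: real assume "\<delta> > 0"
    with \<open>c \<ge> 0\<close> have "\<delta> / (c + 1) * c \<le> \<delta>" "\<delta> / (c + 1) > 0"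
      by (auto simp: field_simps)
    with le[of "\<delta> / (c + 1)"]
    show "norm ((\<integral>x. g x \<partial>\<mu>) - (\<integral>x. g x \<partial>\<nu>)) \<le> 0 + \<delta>"
      by linarith
  qed
  then show "(\<integral>x. g x \<partial>\<mu>) = (\<integral>x. g x \<partial>\<nu>)" by simp
qed

section \<open>Transforms of related kernels and hemigroups, and conditional laws\<close>

lemma transform_return [simp]: "transform \<phi> (return borel x) l = \<phi> l x"
  by (simp add: transform_def integral_return)

text \<open>Relatedness makes the inner integral
  \<open>transform \<phi> (K e) l * \<phi> l (X w)\<close>, whose first factor is constant in
  \<open>w\<close>. With \<open>X\<close> the identity this yields multiplicativity along a
  hemigroup; with the process at time \<open>s\<close> and \<open>M\<close> restricted to an event
  it yields the transform of the predicted law.\<close>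

lemma transform_bind:
  assumes \<mu>: "finite_measure \<mu>" and K: "related_kernel \<phi> e K" and X: "X \<in> \<mu> \<rightarrow>\<^sub>M borel"
  shows "transform \<phi> (\<mu> \<bind> (\<lambda>w. K (X w))) l = transform \<phi> (K e) l * (\<integral>w. \<phi> l (X w) \<partial>\<mu>)"
proof -
  have "K \<in> borel \<rightarrow>\<^sub>M subprob_algebra borel"
    using K by (auto simp: related_kernel_def markov_kernel_def intro: measurable_prob_algebraD)
  then have "(\<lambda>w. K (X w)) \<in> \<mu> \<rightarrow>\<^sub>M subprob_algebra borel"
    using X by measurable
  then have "transform \<phi> (\<mu> \<bind> (\<lambda>w. K (X w))) l = (\<integral>w. transform \<phi> (K (X w)) l \<partial>\<mu>)"
    unfolding transform_def using \<mu> norm_phi_le_1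
    by (intro complex_integral_bind[where K=borel and B=1]) auto
  also have "\<dots> = (\<integral>w. transform \<phi> (K e) l * \<phi> l (X w) \<partial>\<mu>)"
    using K unfolding related_kernel_def by (intro Bochner_Integration.integral_cong refl) blast
  finally show ?thesis by simp
qed

text \<open>Starting at \<open>e\<close>, the composition law writes \<open>P s u e\<close> as the
  mixture of \<open>P t u\<close> under \<open>P s t e\<close>; relatedness turns its transform into
  a product.\<close>

lemma hemigroup_transform_mult:
  assumes P: "hemigroup \<phi> e I P" and I: "s \<in> I" "t \<in> I" "u \<in> I" "s \<le> t" "t \<le> u"
  shows "transform \<phi> (P s u e) l = transform \<phi> (P s t e) l * transform \<phi> (P t u e) l"
proof -
  have st: "related_kernel \<phi> e (P s t)" and tu: "related_kernel \<phi> e (P t u)"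
    and comp: "P s u = kernel_comp (P s t) (P t u)"
    using P I by (auto simp: hemigroup_def)
  have "P s t e \<in> space (prob_algebra borel)"
    using st by (auto simp: related_kernel_def markov_kernel_def intro: measurable_space)
  then have "prob_space (P s t e)" "sets (P s t e) = sets borel"
    by (auto simp: space_prob_algebra)
  then show ?thesis
    using transform_bind[OF _ tu, of "P s t e" "\<lambda>x. x" l]
    by (simp add: comp kernel_comp_def transform_def[of \<phi> "P s t e"] mult.commute
      prob_space.finite_measure measurable_ident_sets)
qed

text \<open>At the first zero \<open>t0\<close> of \<open>h 0\<close>, multiplicativity forces \<open>h s t0 = 0\<close> for all \<open>s < t0\<close>,
  which contradicts continuity at the diagonal, where \<open>h t0 t0 = 1\<close>.\<close>
lemma hemigroup_transform_nonzero:
  assumes P: "hemigroup \<phi> e {0..} P" and "T \<ge> 0"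
  shows "transform \<phi> (P 0 T e) l \<noteq> 0"
proof
  define h where "h s t = transform \<phi> (P s t e) l" for s t
  assume "transform \<phi> (P 0 T e) l = 0"
  then have T: "h 0 T = 0" by (simp add: h_def)
  have h_diag: "h t t = 1" if "t \<ge> 0" for t
  proof -
    have "P t t = return borel" using P that unfolding hemigroup_def by blast
    then show ?thesis by (simp add: h_def phi_e)
  qed
  have mult: "h 0 t = h 0 s * h s t" if "0 \<le> s" "s \<le> t" for s t
    unfolding h_def using that by (intro hemigroup_transform_mult[OF P]) auto
  have "continuous_on {(s, t). s \<in> {0..} \<and> t \<in> {0..} \<and> s \<le> t} (\<lambda>(s, t). \<integral>x. \<phi> l x \<partial>P s t e)"
    using P phi_bcontfun unfolding hemigroup_def by blast
  then have "continuous_on {(s, t). s \<in> {0..} \<and> t \<in> {0..} \<and> s \<le> t} (\<lambda>p. h (fst p) (snd p))"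
    by (simp add: h_def transform_def case_prod_unfold)
  \<comment> \<open>Continuity on the triangle is used along two segments:
    \<open>t -> (0, t)\<close>, to make the zero set closed, and \<open>s -> (s, t0)\<close>, to
    reach the diagonal.\<close>
  note cont = continuous_on_compose2[OF this]
  have c1: "continuous_on {0..T} (\<lambda>t. h 0 t)"
    by (rule cont[of _ "\<lambda>t. (0, t)", simplified fst_conv snd_conv])
      (intro continuous_on_Pair continuous_on_const continuous_on_id, auto)
  define Z where "Z = {t \<in> {0..T}. h 0 t = 0}"
  have "closed Z" unfolding Z_def
    by (rule continuous_closed_preimage_constant[OF c1]) auto
  then have "compact ({0..T} \<inter> Z)" by (intro compact_Int_closed) auto
  moreover have "{0..T} \<inter> Z = Z" by (auto simp: Z_def)
  moreover have "Z \<noteq> {}" using T \<open>T \<ge> 0\<close> by (auto simp: Z_def)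
  ultimately obtain t0 where t0: "t0 \<in> Z" "\<And>t. t \<in> Z \<Longrightarrow> t0 \<le> t"
    by (metis compact_attains_inf)
  have "t0 \<noteq> 0" using t0(1) h_diag[of 0] by (auto simp: Z_def)
  then have "t0 > 0" using t0(1) by (auto simp: Z_def)
  have zero: "h s t0 = 0" if "s \<in> {0..<t0}" for s
  proof -
    have "s \<notin> Z" using t0(2)[of s] that by auto
    then have "h 0 s \<noteq> 0" using that t0(1) by (auto simp: Z_def)
    with mult[of s t0] that t0(1) show ?thesis by (auto simp: Z_def)
  qed
  have c2: "continuous_on {0..t0} (\<lambda>s. h s t0)"
    by (rule cont[of _ "\<lambda>s. (s, t0)", simplified fst_conv snd_conv])
      (intro continuous_on_Pair continuous_on_const continuous_on_id, use \<open>t0 > 0\<close> in auto)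
  have cl: "closure {0..<t0} = {0..t0}" using \<open>t0 > 0\<close> by simp
  have "h t0 t0 = 0"
    using continuous_constant_on_closure[of "{0..<t0}" "\<lambda>s. h s t0" 0 t0] c2 zero \<open>t0 > 0\<close>
    unfolding cl by auto
  with h_diag[of t0] \<open>t0 > 0\<close> show False by simp
qed

text \<open>For an event \<open>A\<close> of the past, both conditions say that the measures
  \<open>B \<mapsto> M(A \<inter> {Xt \<in> B})\<close> and \<open>B \<mapsto> \<integral>\<^sub>A K (Xs w) B dM\<close> agree, the first one on Borel sets and the
  second one on the functions \<open>\<phi> l\<close>.\<close>
lemma cond_exp_kernel_iff:
  fixes M F :: "'w measure"
  assumes M: "prob_space M" and F: "subalgebra M F"
    and Xs: "Xs \<in> F \<rightarrow>\<^sub>M borel" and Xt: "Xt \<in> M \<rightarrow>\<^sub>M borel" and K: "related_kernel \<phi> e K"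
  shows "(\<forall>B\<in>sets borel. AE w in M.
      real_cond_exp M F (indicator (Xt -` B \<inter> space M)) w = measure (K (Xs w)) B) \<longleftrightarrow>
    (\<forall>l. \<forall>A\<in>sets F. (\<integral>w\<in>A. \<phi> l (Xt w) \<partial>M) = transform \<phi> (K e) l * (\<integral>w\<in>A. \<phi> l (Xs w) \<partial>M))"
proof -
  interpret prob_space M by fact
  interpret finite_measure_subalgebra M F
    by unfold_locales (fact F)
  note [measurable] = Xt measurable_from_subalg[OF F Xs]
  have Ksub: "K \<in> borel \<rightarrow>\<^sub>M subprob_algebra borel" and Kprob: "prob_space (K x)" "sets (K x) = sets borel" for x
  proof -
    have *: "K \<in> borel \<rightarrow>\<^sub>M prob_algebra borel"
      using K by (simp add: related_kernel_def markov_kernel_def)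
    then show "K \<in> borel \<rightarrow>\<^sub>M subprob_algebra borel" by (rule measurable_prob_algebraD)
    show "prob_space (K x)" "sets (K x) = sets borel"
      using measurable_space[OF *, of x] by (auto simp: space_prob_algebra)
  qed
  have KXs: "(\<lambda>w. K (Xs w)) \<in> M \<rightarrow>\<^sub>M subprob_algebra borel"
    using Ksub by measurable
  \<comment> \<open>\<open>N A\<close> is \<open>M\<close> restricted to \<open>A\<close>. Under it,
    \<open>\<mu> A\<close> is the actual law of \<open>Xt\<close>, and \<open>\<nu> A\<close> is the
    law predicted by the kernel from \<open>Xs\<close>.\<close>
  define N where "N A = density M (\<lambda>w. ennreal (indicator A w))" for A
  define \<mu> where "\<mu> A = distr (N A) borel Xt" for A
  define \<nu> where "\<nu> A = N A \<bind> (\<lambda>w. K (Xs w))" for A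
  have sN[measurable_cong]: "sets (N A) = sets M" for A by (simp add: N_def)
  have spN [simp]: "space (N A) = space M" for A by (simp add: N_def)
  have AM: "A \<in> sets M" if "A \<in> sets F" for A
    using that F by (auto simp: subalgebra_def)
  have N_int: "(\<integral>w. f w \<partial>N A) = (\<integral>w\<in>A. f w \<partial>M)" if "A \<in> sets F" "f \<in> borel_measurable M"
    for A and f :: "'w \<Rightarrow> complex"
    unfolding N_def using that AM by (intro integral_density_indicator)
  have N_int_real: "(\<integral>w. f w \<partial>N A) = (\<integral>w\<in>A. f w \<partial>M)" if "A \<in> sets F" "f \<in> borel_measurable M"
    for A and f :: "'w \<Rightarrow> real"
    unfolding N_def using that AM by (intro integral_density_indicator)
  have \<mu>_fin: "finite_measure (\<mu> A)" and \<nu>_fin: "finite_measure (\<nu> A)" and \<nu>_sets: "sets (\<nu> A) = sets borel"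
    and N_fin: "finite_measure (N A)" if "A \<in> sets F" for A
  proof -
    have [measurable]: "A \<in> sets M" using AM that .
    have e: "emeasure (N A) (space (N A)) = emeasure M A"
      by (simp add: N_def emeasure_density ennreal_indicator)
    show N_fin: "finite_measure (N A)" using e by (intro finite_measureI) simp
    then interpret N: finite_measure "N A" .
    show "finite_measure (\<mu> A)" unfolding \<mu>_def by (rule N.finite_measure_distr) measurable
    have "subprob_space (N A)"
    proof
      show "emeasure (N A) (space (N A)) \<le> 1" using e emeasure_le_1 by simp
      show "space (N A) \<noteq> {}" using not_empty by (simp add: N_def)
    qed
    then have "subprob_space (\<nu> A)"
      unfolding \<nu>_def using KXs by (intro subprob_space_bind[where N=borel]) (auto simp: N_def)
    then show "finite_measure (\<nu> A)" by (rule subprob_space.axioms)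
    show "sets (\<nu> A) = sets borel"
      unfolding \<nu>_def using not_empty Kprob by (intro sets_bind) (auto simp: N_def)
  qed
  have \<mu>_transform: "transform \<phi> (\<mu> A) l = (\<integral>w\<in>A. \<phi> l (Xt w) \<partial>M)" if "A \<in> sets F" for A l
    unfolding transform_def \<mu>_def using that by (subst integral_distr) (auto simp: N_int)
  have \<nu>_transform: "transform \<phi> (\<nu> A) l = transform \<phi> (K e) l * (\<integral>w\<in>A. \<phi> l (Xs w) \<partial>M)"
    if "A \<in> sets F" for A l
    unfolding \<nu>_def using that by (subst transform_bind[OF N_fin K]) (auto simp: N_int)
  have \<mu>_measure: "measure (\<mu> A) B = (\<integral>w\<in>A. indicator (Xt -` B \<inter> space M) w \<partial>M)"
    if "A \<in> sets F" and [measurable]: "B \<in> sets borel" for A B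
  proof -
    have "measure (\<mu> A) B = measure (N A) (Xt -` B \<inter> space M)"
      unfolding \<mu>_def by (subst measure_distr) auto
    also have "\<dots> = (\<integral>w. indicator (Xt -` B \<inter> space M) w \<partial>N A)"
      by (simp add: Int_assoc)
    also have "\<dots> = (\<integral>w\<in>A. indicator (Xt -` B \<inter> space M) w \<partial>M)"
      using that(1) by (rule N_int_real) measurable
    finally show ?thesis .
  qed
  have K_meas: "(\<lambda>w. measure (K (Xs w)) B) \<in> borel_measurable F" if "B \<in> sets borel" for B
    by (rule measurable_compose[OF Xs measurable_compose[OF Ksub measurable_measure_subprob_algebra[OF that]]])
  have \<nu>_measure: "measure (\<nu> A) B = (\<integral>w\<in>A. measure (K (Xs w)) B \<partial>M)"
    if "A \<in> sets F" and B[measurable]: "B \<in> sets borel" for A B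
  proof -
    have "measure (\<nu> A) B = (\<integral>x. indicator B x \<partial>\<nu> A)"
      using \<nu>_sets[OF that(1)] sets_eq_imp_space_eq[OF \<nu>_sets[OF that(1)]] by simp
    also have "\<dots> = (\<integral>w. \<integral>x. indicator B x \<partial>K (Xs w) \<partial>N A)"
      unfolding \<nu>_def
    proof (rule integral_bind[where K=borel and B=1 and B'=1])
      show "(\<lambda>w. K (Xs w)) \<in> N A \<rightarrow>\<^sub>M subprob_algebra borel" using KXs by measurable
      show "finite_measure (N A)" using that(1) by (rule N_fin)
      show "AE w in N A. emeasure (K (Xs w)) (space (K (Xs w))) \<le> ennreal 1"
        by (simp add: prob_space.emeasure_space_1[OF Kprob(1)])
    qed (auto simp: indicator_def)
    also have "\<dots> = (\<integral>w. measure (K (Xs w)) B \<partial>N A)"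
      using sets_eq_imp_space_eq[OF Kprob(2)] by simp
    also have "\<dots> = (\<integral>w\<in>A. measure (K (Xs w)) B \<partial>M)"
      using that(1) measurable_from_subalg[OF F K_meas[OF B]] by (rule N_int_real)
    finally show ?thesis .
  qed
  \<comment> \<open>For each Borel set separately, the conditional probability identity becomes a
    family of identities over events, whose two sides are the values of \<open>\<mu> A\<close> and
    \<open>\<nu> A\<close>.\<close>
  have "(\<forall>B\<in>sets borel. AE w in M.
      real_cond_exp M F (indicator (Xt -` B \<inter> space M)) w = measure (K (Xs w)) B) \<longleftrightarrow>
    (\<forall>B\<in>sets borel. \<forall>A\<in>sets F. measure (\<mu> A) B = measure (\<nu> A) B)"
  proof (intro ball_cong refl)
    fix B :: "'x set" assume B[measurable]: "B \<in> sets borel"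
    have "integrable M (indicator (Xt -` B \<inter> space M) :: 'w \<Rightarrow> real)"
      by (intro integrable_const_bound[where B=1]) auto
    moreover have "integrable M (\<lambda>w. measure (K (Xs w)) B)"
      using measurable_from_subalg[OF F K_meas[OF B]] prob_space.prob_le_1[OF Kprob(1)]
      by (intro integrable_const_bound[where B=1]) auto
    ultimately show "(AE w in M. real_cond_exp M F (indicator (Xt -` B \<inter> space M)) w = measure (K (Xs w)) B) \<longleftrightarrow>
        (\<forall>A\<in>sets F. measure (\<mu> A) B = measure (\<nu> A) B)"
      using B by (subst real_cond_exp_charact_iff) (auto simp: K_meas \<mu>_measure \<nu>_measure)
  qed
  \<comment> \<open>Exchanging the quantifiers over \<open>A\<close> and \<open>B\<close> gives
    equality of whole measures; finiteness allows the passage from real values to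
    \<open>emeasure\<close>.\<close>
  also have "\<dots> \<longleftrightarrow> (\<forall>A\<in>sets F. \<mu> A = \<nu> A)"
  proof -
    have "\<mu> A = \<nu> A" if A: "A \<in> sets F" and *: "\<forall>B\<in>sets borel. measure (\<mu> A) B = measure (\<nu> A) B" for A
    proof (rule measure_eqI)
      show "sets (\<mu> A) = sets (\<nu> A)" using \<nu>_sets[OF A] by (simp add: \<mu>_def)
      fix B assume "B \<in> sets (\<mu> A)"
      then show "emeasure (\<mu> A) B = emeasure (\<nu> A) B"
        using * finite_measure.emeasure_eq_measure[OF \<mu>_fin[OF A]]
          finite_measure.emeasure_eq_measure[OF \<nu>_fin[OF A]] by (simp add: \<mu>_def)
    qed
    then show ?thesis by auto
  qed
  \<comment> \<open>The implication from transforms back to measures is where injectivity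
    enters.\<close>
  also have "\<dots> \<longleftrightarrow> (\<forall>A\<in>sets F. \<forall>l. transform \<phi> (\<mu> A) l = transform \<phi> (\<nu> A) l)"
    using transform_inject \<mu>_fin \<nu>_fin \<nu>_sets by (intro ball_cong refl) (auto simp: \<mu>_def)
  also have "\<dots> \<longleftrightarrow> (\<forall>l. \<forall>A\<in>sets F. (\<integral>w\<in>A. \<phi> l (Xt w) \<partial>M) = transform \<phi> (K e) l * (\<integral>w\<in>A. \<phi> l (Xs w) \<partial>M))"
    by (auto simp: \<mu>_transform \<nu>_transform)
  finally show ?thesis .
qed

end

section \<open>The canonical filtration and the martingale characterisation\<close>

lemma
  assumes X: "\<forall>t\<in>I. X t \<in> M \<rightarrow>\<^sub>M borel"
  shows filtration_canonical_filtration: "filtration (space M) (canonical_filtration M I X)"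
    and subalgebra_canonical_filtration: "subalgebra M (canonical_filtration M I X t)"
    and measurable_canonical_filtration:
      "s \<in> I \<Longrightarrow> s \<le> t \<Longrightarrow> X s \<in> canonical_filtration M I X t \<rightarrow>\<^sub>M borel"
proof -
  define G where "G t = {X s -` B \<inter> space M | s B. s \<in> I \<and> s \<le> t \<and> B \<in> sets borel}" for t
  have F: "canonical_filtration M I X t = sigma (space M) (G t)" for t
    by (simp add: canonical_filtration_def G_def)
  have Pow: "G t \<subseteq> Pow (space M)" for t by (auto simp: G_def)
  have GM: "G t \<subseteq> sets M" for t using X by (auto simp: G_def intro: measurable_sets)
  have "G s \<subseteq> G t" if "s \<le> t" for s t using that by (fastforce simp: G_def)
  then show "filtration (space M) (canonical_filtration M I X)"
    using Pow by (intro filtration.intro) (auto simp: F space_measure_of_conv intro!: sigma_sets_mono')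
  show "subalgebra M (canonical_filtration M I X t)"
    using GM Pow by (auto simp: subalgebra_def F space_measure_of_conv dest: set_mp[OF sets.sigma_sets_subset[OF GM]])
  show "X s \<in> canonical_filtration M I X t \<rightarrow>\<^sub>M borel" if "s \<in> I" "s \<le> t"
  proof (rule measurableI)
    show "X s -` B \<inter> space (canonical_filtration M I X t) \<in> sets (canonical_filtration M I X t)"
      if "B \<in> sets borel" for B
      using that \<open>s \<in> I\<close> \<open>s \<le> t\<close> Pow
      by (auto simp: F space_measure_of_conv G_def intro!: sigma_sets.Basic)
  qed simp
qed

text \<open>In discrete time the index set has no accumulation at the diagonal, so continuity does
  not exclude zeros of the transforms, and \<open>1 / 0 = 0\<close> would turn the quotient into the
  constant 0. Nonvanishing is therefore a hypothesis for \<open>I = \<nat>\<close>; for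
  \<open>I = {0..}\<close> it follows from \<open>hemigroup_transform_nonzero\<close>.\<close>

theorem theorem4p25:
  fixes \<phi> :: "'l::t2_space \<Rightarrow> 'x::{second_countable_topology, t2_space} \<Rightarrow> complex"
    and e :: 'x
    and I :: "real set"
    and P :: "real \<Rightarrow> real \<Rightarrow> 'x \<Rightarrow> 'x measure"
    and M :: "'w measure"
    and X :: "real \<Rightarrow> 'w \<Rightarrow> 'x"
  assumes "abstract_integral_transform \<phi> e"
    and "I = {0..} \<or> I = \<nat>"
    and "hemigroup \<phi> e I P"
    and "I = \<nat> \<Longrightarrow> \<forall>t\<in>I. \<forall>l. transform \<phi> (P 0 t e) l \<noteq> 0"
    and "prob_space M"
    and "\<forall>t\<in>I. X t \<in> M \<rightarrow>\<^sub>M borel"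
  shows "markov_process_related M I P X \<longleftrightarrow>
    (\<forall>l. complex_martingale M (canonical_filtration M I X) I
            (\<lambda>t w. 1 / transform \<phi> (P 0 t e) l * \<phi> l (X t w)))"
proof -
  interpret abstract_integral_transform \<phi> e by fact
  interpret prob_space M by fact
  note P = assms(3) and X = assms(6)
  define F where "F = canonical_filtration M I X"
  define h where "h s t l = transform \<phi> (P s t e) l" for s t l
  have F_sub: "subalgebra M (F t)" for t
    unfolding F_def by (rule subalgebra_canonical_filtration[OF X])
  have XF: "X t \<in> F t \<rightarrow>\<^sub>M borel" if "t \<in> I" for t
    unfolding F_def using that by (intro measurable_canonical_filtration[OF X]) auto
  have I0: "0 \<in> I" "t \<in> I \<Longrightarrow> 0 \<le> t" for t using assms(2) by (auto simp: Nats_def)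
  have nz: "h 0 t l \<noteq> 0" if "t \<in> I" for t l
    using assms(2)
  proof
    assume "I = {0..}"
    then show ?thesis
      unfolding h_def using hemigroup_transform_nonzero[of P t l] P that by simp
  qed (use assms(4) that in \<open>simp add: h_def\<close>)
  have adapted: "(\<lambda>w. 1 / h 0 t l * \<phi> l (X t w)) \<in> borel_measurable (F t)" if "t \<in> I" for t l
    using XF[OF that] by measurable
  have phi_int: "integrable M (\<lambda>w. \<phi> l (X t w))" if "t \<in> I" for t l
  proof (rule integrable_const_bound[where B=1])
    have "X t \<in> M \<rightarrow>\<^sub>M borel" using X that by blast
    then show "(\<lambda>w. \<phi> l (X t w)) \<in> borel_measurable M" by measurable
  qed (use norm_phi_le_1 in auto)
  have "markov_process_related M I P X \<longleftrightarrow> (\<forall>s\<in>I. \<forall>t\<in>I. s \<le> t \<longrightarrow> (\<forall>l. \<forall>A\<in>sets (F s).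
      (\<integral>w\<in>A. \<phi> l (X t w) \<partial>M) = h s t l * (\<integral>w\<in>A. \<phi> l (X s w) \<partial>M)))"
    unfolding markov_process_related_def F_def[symmetric] h_def
  proof (intro ball_cong imp_cong refl)
    fix s t assume "s \<in> I" "t \<in> I" "s \<le> t"
    then have K: "related_kernel \<phi> e (P s t)" using P by (auto simp: hemigroup_def)
    show "(\<forall>B\<in>sets borel. AE w in M. real_cond_exp M (F s) (indicator (X t -` B \<inter> space M)) w = measure (P s t (X s w)) B)
      \<longleftrightarrow> (\<forall>l. \<forall>A\<in>sets (F s). (\<integral>w\<in>A. \<phi> l (X t w) \<partial>M) = transform \<phi> (P s t e) l * (\<integral>w\<in>A. \<phi> l (X s w) \<partial>M))"
      using X \<open>t \<in> I\<close> by (intro cond_exp_kernel_iff[OF assms(5) F_sub XF[OF \<open>s \<in> I\<close>] _ K]) auto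
  qed
  also have "\<dots> \<longleftrightarrow> (\<forall>s\<in>I. \<forall>t\<in>I. s \<le> t \<longrightarrow> (\<forall>l. AE w in M.
      complex_cond_exp M (F s) (\<lambda>w. 1 / h 0 t l * \<phi> l (X t w)) w = 1 / h 0 s l * \<phi> l (X s w)))"
  proof (intro ball_cong imp_cong all_cong1 refl)
    fix s t l assume st: "s \<in> I" "t \<in> I" "s \<le> t"
    interpret finite_measure_subalgebra M "F s" by unfold_locales (rule F_sub)
    have ht: "h 0 t l = h 0 s l * h s t l"
      unfolding h_def using st I0 by (intro hemigroup_transform_mult[OF P]) auto
    \<comment> \<open>Both normalising factors are nonzero, and
      \<open>h 0 t l = h 0 s l * h s t l\<close>; hence dividing by \<open>h 0 t l\<close> absorbs
      the kernel factor \<open>h s t l\<close>.\<close>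
    have "(\<integral>w\<in>A. \<phi> l (X t w) \<partial>M) = h s t l * (\<integral>w\<in>A. \<phi> l (X s w) \<partial>M) \<longleftrightarrow>
      (\<integral>w\<in>A. 1 / h 0 t l * \<phi> l (X t w) \<partial>M) = (\<integral>w\<in>A. 1 / h 0 s l * \<phi> l (X s w) \<partial>M)" for A
      using nz[OF st(1), of l] nz[OF st(2), of l]
      unfolding set_integral_mult_right ht by (simp add: field_simps)
    then show "(\<forall>A\<in>sets (F s). (\<integral>w\<in>A. \<phi> l (X t w) \<partial>M) = h s t l * (\<integral>w\<in>A. \<phi> l (X s w) \<partial>M)) \<longleftrightarrow>
      (AE w in M. complex_cond_exp M (F s) (\<lambda>w. 1 / h 0 t l * \<phi> l (X t w)) w = 1 / h 0 s l * \<phi> l (X s w))"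
      using phi_int st adapted by (subst complex_cond_exp_charact) auto
  qed
  \<comment> \<open>The remaining martingale conditions hold automatically: the process is adapted
    to its own filtration, and the quotients are bounded at each time.\<close>
  also have "\<dots> \<longleftrightarrow> (\<forall>l. complex_martingale M F I (\<lambda>t w. 1 / h 0 t l * \<phi> l (X t w)))"
    unfolding complex_martingale_def
    using filtration_canonical_filtration[OF X] F_sub adapted phi_int by (auto simp: F_def)
  finally show ?thesis by (simp add: F_def h_def)
qed

end
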